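(* Let $0\le l<\tfrac14$, let $r=1-2l$, and let $M=M_x\cup M_y\cup M_z\cup M_2\subset[0,1]^3$ where $$M_x=\{(t,1-2t,1-2t):0\le t\le l\},\quad M_y=\{(1-2t,t,1-2t):0\le t\le l\},$$ $$M_z=\{(1-2t,1-2t,t):0\le t\le l\},\quad M_2=\{(x,y,z): l\le x,y,z\le r,\ xyz=lr^2\}.$$ Then the integral $\int xyz\,d\nu(x,y,z)$ has the same value for all Borel probability measures $\nu$ on $[0,1]^3$ such that the projections of $\nu$ onto each of the three coordinate axes are equal to Lebesgue measure on $[0,1]$ and $\operatorname{supp}(\nu)\subset M$.
   Context: No further definitions are needed; "projection" means the push-forward (marginal) under a coordinate map. *)

theory Defs
  imports "HOL-Probability.Probability"
begin

definition unit_cube :: "(real \<times> real \<times> real) set" where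
  "unit_cube = {0..1} \<times> {0..1} \<times> {0..1}"

definition M_x :: "real \<Rightarrow> (real \<times> real \<times> real) set" where
  "M_x l = {(t, 1 - 2 * t, 1 - 2 * t) | t. 0 \<le> t \<and> t \<le> l}"

definition M_y :: "real \<Rightarrow> (real \<times> real \<times> real) set" where
  "M_y l = {(1 - 2 * t, t, 1 - 2 * t) | t. 0 \<le> t \<and> t \<le> l}"

definition M_z :: "real \<Rightarrow> (real \<times> real \<times> real) set" where
  "M_z l = {(1 - 2 * t, 1 - 2 * t, t) | t. 0 \<le> t \<and> t \<le> l}"

definition M_2 :: "real \<Rightarrow> real \<Rightarrow> (real \<times> real \<times> real) set" where
  "M_2 l r = {(x, y, z). l \<le> x \<and> x \<le> r \<and> l \<le> y \<and> y \<le> r \<and> l \<le> z \<and> z \<le> r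
                \<and> x * y * z = l * r ^ 2}"

definition M_set :: "real \<Rightarrow> real \<Rightarrow> (real \<times> real \<times> real) set" where
  "M_set l r = M_x l \<union> M_y l \<union> M_z l \<union> M_2 l r"

text \<open>Topological support of a Borel measure whose underlying space is a subspace of
  the ambient topological space: the points all of whose relatively open neighbourhoods
  have positive measure.\<close>

definition measure_support :: "'a::topological_space measure \<Rightarrow> 'a set" where
  "measure_support \<nu> =
     {p \<in> space \<nu>. \<forall>U. open U \<and> p \<in> U \<longrightarrow> emeasure \<nu> (U \<inter> space \<nu>) > 0}"

definition borel_prob_on_cube :: "(real \<times> real \<times> real) measure \<Rightarrow> bool" where
  "borel_prob_on_cube \<nu> \<longleftrightarrow> prob_space \<nu> \<and> sets \<nu> = sets (restrict_space borel unit_cube)"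

definition uniform_marginals :: "(real \<times> real \<times> real) measure \<Rightarrow> bool" where
  "uniform_marginals \<nu> \<longleftrightarrow>
     distr \<nu> (restrict_space borel {0..1}) (\<lambda>(x, y, z). x) = restrict_space lborel {0..1} \<and>
     distr \<nu> (restrict_space borel {0..1}) (\<lambda>(x, y, z). y) = restrict_space lborel {0..1} \<and>
     distr \<nu> (restrict_space borel {0..1}) (\<lambda>(x, y, z). z) = restrict_space lborel {0..1}"

end

theory Submission
  imports Defs
begin

text \<open>On M the integrand is a sum of one-variable functions: there is a bounded Borel
  function f with $xyz = f(x) + f(y) + f(z)$ on M, so the integral depends on the marginals only.
  Since $xyz$ is constant on \<^const>\<open>M_2\<close>, one may take f constant on $[l,r]$ and zero on $[0,l)$;
  the three curves then determine f on $(r,1]$.\<close>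

text \<open>For s = 1 - 2t the factor (1 - s) / 2 is the curve parameter t, so the last piece is t *
  (1 - 2t)^2 / 2: half of xyz for each of the two equal coordinates. The middle piece splits the
  constant value l * r^2 on \<open>M_2\<close> evenly over three coordinates.\<close>

definition dual_fun :: "real \<Rightarrow> real \<Rightarrow> real \<Rightarrow> real" where
  "dual_fun l r s =
     (if s < l then 0 else if s \<le> r then l * r ^ 2 / 3 else (1 - s) / 2 * s ^ 2 / 2)"

lemma dual_fun_measurable [measurable]: "dual_fun l r \<in> borel_measurable borel"
  unfolding dual_fun_def by measurable

text \<open>Supplies integrability under a probability measure. The bound adds the bounds of the
  pieces, with an absolute value since the sign of l is left open. The cubic piece is unbounded on
  the whole line, hence the restriction to [0,1].\<close>

lemma dual_fun_bounded:
  assumes "s \<in> {0..1}"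
  shows "\<bar>dual_fun l r s\<bar> \<le> \<bar>l * r ^ 2 / 3\<bar> + 1"
proof -
  have "(1 - s) * s ^ 2 \<le> 1 * 1"
    using assms by (intro mult_mono) (auto simp: power_le_one)
  moreover have "(1 - s) * s ^ 2 \<ge> 0"
    using assms by auto
  ultimately have "\<bar>(1 - s) / 2 * s ^ 2 / 2\<bar> \<le> 1"
    by simp
  then show ?thesis
    unfolding dual_fun_def by auto
qed

lemma dual_fun_curve:
  assumes "0 \<le> t" and "t \<le> l" and "l < 1 / 4" and "r = 1 - 2 * l"
  shows "dual_fun l r t + 2 * dual_fun l r (1 - 2 * t) = t * (1 - 2 * t) ^ 2"
  \<comment> \<open>For t < l the point 1 - 2t exceeds r, so the outer pieces apply. At t = l both l
    and r are ends of the closed middle piece (l < 1/4 gives l \<le> r), and three thirds of l * r^2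
    remain.\<close>
  using assms by (cases "t = l") (auto simp: dual_fun_def)

text \<open>Each curve is a permutation of (t, 1 - 2t, 1 - 2t), so \<open>dual_fun_curve\<close>
  settles it. On \<open>M_2\<close> all coordinates lie in [l, r], where three equal constants add
  up to l * r^2.\<close>

lemma sum_dual_fun_on_M_set:
  assumes "l < 1 / 4" and "r = 1 - 2 * l" and "(x, y, z) \<in> M_set l r"
  shows "x * y * z = dual_fun l r x + dual_fun l r y + dual_fun l r z"
proof -
  consider (x) t where "0 \<le> t" "t \<le> l" "x = t" "y = 1 - 2 * t" "z = 1 - 2 * t"
    | (y) t where "0 \<le> t" "t \<le> l" "x = 1 - 2 * t" "y = t" "z = 1 - 2 * t"
    | (z) t where "0 \<le> t" "t \<le> l" "x = 1 - 2 * t" "y = 1 - 2 * t" "z = t"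
    | (surface) "(x, y, z) \<in> M_2 l r"
    using assms(3) unfolding M_set_def M_x_def M_y_def M_z_def by blast
  then show ?thesis
  proof cases
    case (x t)
    then show ?thesis
      using dual_fun_curve[OF x(1,2) assms(1,2)] by (simp add: power2_eq_square)
  next
    case (y t)
    then show ?thesis
      using dual_fun_curve[OF y(1,2) assms(1,2)] by (simp add: power2_eq_square mult_ac)
  next
    case (z t)
    then show ?thesis
      using dual_fun_curve[OF z(1,2) assms(1,2)] by (simp add: power2_eq_square mult_ac)
  next
    case surface
    then show ?thesis
      by (auto simp: M_2_def dual_fun_def)
  qed
qed

text \<open>A point outside the support has a null open neighbourhood, which contains a basic open
  set around the point, null by monotonicity. A countable basis has only countably many null
  members, so their union is a null set covering the complement of the support.\<close>

lemma AE_in_measure_support: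
  fixes \<nu> :: "'a::second_countable_topology measure"
  assumes open_sets: "\<And>U. open U \<Longrightarrow> U \<inter> space \<nu> \<in> sets \<nu>"
  shows "AE p in \<nu>. p \<in> measure_support \<nu>"
proof -
  obtain B :: "'a set set" where B: "countable B" "topological_basis B"
    using ex_countable_basis by blast
  define N where "N = {U \<in> B. emeasure \<nu> (U \<inter> space \<nu>) = 0}"
  have "countable N"
    using B(1) unfolding N_def by auto
  moreover have "\<And>U. U \<in> N \<Longrightarrow> U \<inter> space \<nu> \<in> null_sets \<nu>"
    using topological_basis_open[OF B(2)] open_sets by (auto simp: N_def null_sets_def)
  ultimately have "(\<Union>U\<in>N. U \<inter> space \<nu>) \<in> null_sets \<nu>"
    by (rule null_sets_UN')
  moreover have "{p \<in> space \<nu>. p \<notin> measure_support \<nu>} \<subseteq> (\<Union>U\<in>N. U \<inter> space \<nu>)"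
  proof
    fix p assume "p \<in> {p \<in> space \<nu>. p \<notin> measure_support \<nu>}"
    then obtain U where p: "p \<in> space \<nu>" and U: "open U" "p \<in> U" "emeasure \<nu> (U \<inter> space \<nu>) = 0"
      by (auto simp: measure_support_def zero_less_iff_neq_zero)
    from topological_basisE[OF B(2) U(1,2)]
    obtain V where V: "V \<in> B" "p \<in> V" "V \<subseteq> U" .
    have "emeasure \<nu> (V \<inter> space \<nu>) \<le> emeasure \<nu> (U \<inter> space \<nu>)"
      using V(3) open_sets[OF U(1)] by (intro emeasure_mono) auto
    then show "p \<in> (\<Union>U\<in>N. U \<inter> space \<nu>)"
      using U(3) V p by (auto simp: N_def)
  qed
  ultimately show ?thesis
    by (rule AE_I')
qed

text \<open>Change of variables along g. A bound for f on S is enough, since g maps the space of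
  \<nu> into S.\<close>

lemma integral_marginal:
  fixes f :: "real \<Rightarrow> real"
  assumes "prob_space \<nu>" and "distr \<nu> (restrict_space borel S) g = \<mu>"
    and g: "g \<in> measurable \<nu> (restrict_space borel S)"
    and [measurable]: "f \<in> borel_measurable borel"
    and bounded: "\<And>s. s \<in> S \<Longrightarrow> \<bar>f s\<bar> \<le> B"
  shows "integrable \<nu> (\<lambda>p. f (g p))" and "(\<integral>p. f (g p) \<partial>\<nu>) = (\<integral>s. f s \<partial>\<mu>)"
proof -
  interpret prob_space \<nu> by fact
  have f: "f \<in> borel_measurable (restrict_space borel S)"
    by (simp add: measurable_restrict_space1)
  have "AE p in \<nu>. norm (f (g p)) \<le> B"
    using measurable_space[OF g] bounded by (auto simp: space_restrict_space)
  then show "integrable \<nu> (\<lambda>p. f (g p))"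
    using measurable_compose[OF g f] by (rule integrable_const_bound)
  show "(\<integral>p. f (g p) \<partial>\<nu>) = (\<integral>s. f s \<partial>\<mu>)"
    unfolding assms(2)[symmetric] by (rule integral_distr[OF g f, symmetric])
qed

text \<open>The right-hand side does not mention \<nu>, so two admissible measures give the same
  integral.\<close>

lemma integral_eq_dual:
  assumes "l < 1 / 4" and "r = 1 - 2 * l"
    and \<nu>: "borel_prob_on_cube \<nu>" "uniform_marginals \<nu>" "measure_support \<nu> \<subseteq> M_set l r"
  shows "(\<integral>(x, y, z). x * y * z \<partial>\<nu>) = 3 * (\<integral>s. dual_fun l r s \<partial>restrict_space lborel {0..1})"
proof -
  have prob: "prob_space \<nu>" and sets: "sets \<nu> = sets (restrict_space borel unit_cube)"
    using \<nu>(1) by (auto simp: borel_prob_on_cube_def)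
  have space: "space \<nu> = unit_cube"
    using sets_eq_imp_space_eq[OF sets] by (simp add: space_restrict_space)
  have meas: "g \<in> measurable \<nu> (restrict_space borel {0..1})"
    if "g \<in> borel_measurable borel" "g ` unit_cube \<subseteq> {0..1}" for g :: "real \<times> real \<times> real \<Rightarrow> real"
    using that unfolding measurable_cong_sets[OF sets refl]
    by (intro measurable_restrict_space3) auto
  have x: "(\<lambda>(x, y, z). x) \<in> measurable \<nu> (restrict_space borel {0..1})"
    and y: "(\<lambda>(x, y, z). y) \<in> measurable \<nu> (restrict_space borel {0..1})"
    and z: "(\<lambda>(x, y, z). z) \<in> measurable \<nu> (restrict_space borel {0..1})"
    unfolding case_prod_unfold
    by (rule meas; auto simp: unit_cube_def intro!: borel_measurable_continuous_onI continuous_intros)+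
  let ?f = "dual_fun l r"
  let ?I = "\<integral>s. ?f s \<partial>restrict_space lborel {0..1}"
  note marginals = \<nu>(2)[unfolded uniform_marginals_def]
  note X = integral_marginal[OF prob conjunct1[OF marginals] x dual_fun_measurable dual_fun_bounded]
  note Y = integral_marginal[OF prob conjunct1[OF conjunct2[OF marginals]] y
      dual_fun_measurable dual_fun_bounded]
  note Z = integral_marginal[OF prob conjunct2[OF conjunct2[OF marginals]] z
      dual_fun_measurable dual_fun_bounded]
  have "U \<inter> space \<nu> \<in> sets \<nu>" if "open U" for U
    using that by (auto simp: sets space sets_restrict_space)
  then have "AE p in \<nu>. p \<in> measure_support \<nu>"
    by (rule AE_in_measure_support)
  \<comment> \<open>Almost every point lies in the support, hence in M, which turns the pointwise
    identity on M into one almost everywhere.\<close>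
  then have ae: "AE p in \<nu>. (case p of (x, y, z) \<Rightarrow> x * y * z) =
      ?f (case p of (x, y, z) \<Rightarrow> x) + ?f (case p of (x, y, z) \<Rightarrow> y) + ?f (case p of (x, y, z) \<Rightarrow> z)"
    using \<nu>(3) sum_dual_fun_on_M_set[OF assms(1,2)] by (auto elim!: eventually_mono)
  have "(\<lambda>(x, y, z). x * y * z) \<in> borel_measurable (borel :: (real \<times> real \<times> real) measure)"
    unfolding case_prod_unfold
    by (intro borel_measurable_continuous_onI continuous_intros)
  then have "(\<lambda>(x, y, z). x * y * z) \<in> borel_measurable \<nu>"
    unfolding measurable_cong_sets[OF sets refl] by (rule measurable_restrict_space1)
  then have "(\<integral>(x, y, z). x * y * z \<partial>\<nu>) = (\<integral>p. ?f (case p of (x, y, z) \<Rightarrow> x) +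
      ?f (case p of (x, y, z) \<Rightarrow> y) + ?f (case p of (x, y, z) \<Rightarrow> z) \<partial>\<nu>)"
    by (intro integral_cong_AE borel_measurable_add ae X(1)[THEN borel_measurable_integrable]
        Y(1)[THEN borel_measurable_integrable] Z(1)[THEN borel_measurable_integrable])
  also have "\<dots> = ?I + ?I + ?I"
    \<comment> \<open>The integrability halves of \<open>X\<close>, \<open>Y\<close>,
      \<open>Z\<close> justify splitting the sum; the other halves replace each summand by the same
      integral over [0,1].\<close>
    by (simp only: X Y Z Bochner_Integration.integral_add Bochner_Integration.integrable_add)
  finally show ?thesis
    by simp
qed

theorem proposition3p1:
  fixes l r :: real
    and \<nu> \<nu>' :: "(real \<times> real \<times> real) measure"
  assumes "0 \<le> l" and "l < 1 / 4" and "r = 1 - 2 * l"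
    and "borel_prob_on_cube \<nu>" and "uniform_marginals \<nu>"
    and "measure_support \<nu> \<subseteq> M_set l r"
    and "borel_prob_on_cube \<nu>'" and "uniform_marginals \<nu>'"
    and "measure_support \<nu>' \<subseteq> M_set l r"
  shows "(\<integral>(x, y, z). x * y * z \<partial>\<nu>) = (\<integral>(x, y, z). x * y * z \<partial>\<nu>')"
  using assms integral_eq_dual by simp

end
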